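(* Let $\Gamma_1=(G_1,\sigma_1)$ be a signed bipartite graph of order $n$ with exactly two distinct eigenvalues $\pm\theta_1$, and let $\Gamma_2=(G_2,\sigma_2)$ be a signed graph of order $m$ with exactly two distinct eigenvalues $\pm\theta_2$. If $H$ and $H'$ are arbitrary $(\frac{mn}{2}+1)$-vertex induced subgraphs of the signed Cartesian product $\Gamma_1\widetilde{\Box}\Gamma_2$ and of the signed semi-strong product $\Gamma_1\widetilde{\bowtie}\Gamma_2$, respectively, then $$\Delta(H)\geq\sqrt{\theta_1^2+\theta_2^2},\qquad \Delta(H')\geq\sqrt{(\theta_1^2+1)\theta_2^2}.$$
   Context: A signed graph $\Gamma=(G,\sigma)$ is a finite simple undirected graph $G$ together with a map $\sigma:E(G)\to\{+1,-1\}$. Its adjacency matrix $A(\Gamma)$ is the real symmetric matrix indexed by $V(G)$ whose $(u,v)$ entry is $\sigma(uv)$ if $u,v$ are adjacent and $0$ otherwise. The eigenvalues (spectrum) of $\Gamma$ are those of $A(\Gamma)$. Graph notions (order, bipartite, induced subgraph, maximum degree $\Delta$) refer to the underlying graph $G$. A signed bipartite graph $\Gamma_1$ of order $n$ is taken with a fixed bipartition $(V_1,V_2)$, $|V_1|=s$ (unique up to interchanging the classes when the graph is connected). Labeling the vertices of $V_1$ first, $A(\Gamma_1)=\begin{bmatrix}O_s&P\\P^T&O_{n-s}\end{bmatrix}$. For a signed graph $\Gamma_2$ of order $m$, the signed Cartesian product $\Gamma_1\widetilde{\Box}\Gamma_2$ and the signed semi-strong product $\Gamma_1\widetilde{\bowtie}\Gamma_2$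 are the signed graphs on $V(G_1)\times V(G_2)$ with adjacency matrices $$A(\Gamma_1\widetilde{\Box}\Gamma_2)=A(\Gamma_1)\otimes I_m+\begin{bmatrix}I_s&O\\O&-I_{n-s}\end{bmatrix}\otimes A(\Gamma_2),\qquad A(\Gamma_1\widetilde{\bowtie}\Gamma_2)=\begin{bmatrix}I_s&P\\P^T&-I_{n-s}\end{bmatrix}\otimes A(\Gamma_2),$$ where $\otimes$ is the Kronecker product. *)

theory Defs
  imports "HOL-Analysis.Analysis"
begin

record 'a sgraph =
  verts :: "'a set"
  edges :: "'a set set"
  sign :: "'a set \<Rightarrow> real"

text \<open>The values of \<^term>\<open>sign G\<close> outside \<^term>\<open>edges G\<close> are irrelevant.\<close>

definition signed_graph :: "'a sgraph \<Rightarrow> bool" where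
  "signed_graph G \<longleftrightarrow>
     finite (verts G) \<and>
     (\<forall>e\<in>edges G. e \<subseteq> verts G \<and> card e = 2) \<and>
     (\<forall>e\<in>edges G. sign G e = 1 \<or> sign G e = -1)"

definition induced_subgraph :: "'a sgraph \<Rightarrow> 'a sgraph \<Rightarrow> bool" where
  "induced_subgraph H G \<longleftrightarrow>
     verts H \<subseteq> verts G \<and>
     edges H = {e \<in> edges G. e \<subseteq> verts H} \<and>
     (\<forall>e\<in>edges H. sign H e = sign G e)"

definition degree :: "'a sgraph \<Rightarrow> 'a \<Rightarrow> nat" where
  "degree G u = card {v \<in> verts G. {u, v} \<in> edges G}"

definition max_degree :: "'a sgraph \<Rightarrow> nat" where
  "max_degree G = Max (degree G ` verts G)"

definition bipartition :: "'a sgraph \<Rightarrow> 'a set \<Rightarrow> 'a set \<Rightarrow> bool" where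
  "bipartition G V1 V2 \<longleftrightarrow>
     V1 \<union> V2 = verts G \<and> V1 \<inter> V2 = {} \<and>
     (\<forall>e\<in>edges G. \<exists>u\<in>V1. \<exists>v\<in>V2. e = {u, v})"

text \<open>Matrices are indexed by a finite type, so \<open>adjacency G\<close> is the adjacency matrix of \<open>G\<close>
  precisely when \<^prop>\<open>verts G = UNIV\<close>; for smaller vertex sets it is padded with zero rows
  and columns, which would add the eigenvalue 0.\<close>

definition adjacency :: "'a::finite sgraph \<Rightarrow> real ^ 'a ^ 'a" where
  "adjacency G = (\<chi> u v. if {u, v} \<in> edges G then sign G {u, v} else 0)"

definition spectrum :: "real ^ 'a ^ 'a \<Rightarrow> real set" where
  "spectrum A = {k. \<exists>x. x \<noteq> 0 \<and> A *v x = k *\<^sub>R x}"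

definition kronecker ::
    "real ^ 'a ^ 'a \<Rightarrow> real ^ 'b ^ 'b \<Rightarrow> real ^ ('a \<times> 'b) ^ ('a \<times> 'b)" (infixl \<open>\<otimes>\<^sub>K\<close> 70) where
  "A \<otimes>\<^sub>K B = (\<chi> p q. A $ fst p $ fst q * B $ snd p $ snd q)"

text \<open>The matrix with diagonal blocks \<open>I\<close> on \<open>V1\<close> and \<open>-I\<close> on the complement, independent of
  a labelling of the vertices.\<close>

definition class_diag :: "'a set \<Rightarrow> real ^ 'a ^ 'a" where
  "class_diag V1 = (\<chi> u v. if u = v then (if u \<in> V1 then 1 else -1) else 0)"

text \<open>The signed graph on \<open>V\<close> with adjacency matrix \<open>M\<close>; meaningful for symmetric \<open>M\<close> with zero
  diagonal and entries in \<open>{-1,0,1}\<close>. By symmetry of \<open>M\<close> the sign does not depend on how an edge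
  is written as \<open>{u, v}\<close>.\<close>

definition sgraph_of_matrix :: "'a set \<Rightarrow> real ^ 'a ^ 'a \<Rightarrow> 'a sgraph" where
  "sgraph_of_matrix V M =
     \<lparr>verts = V,
      edges = {{u, v} | u v. u \<in> V \<and> v \<in> V \<and> M $ u $ v \<noteq> 0},
      sign = (\<lambda>e. THE s. \<exists>u v. e = {u, v} \<and> s = M $ u $ v)\<rparr>"

text \<open>Both products depend on the bipartition of the first factor, given by its first class
  \<open>V1\<close>. When the vertices of \<open>V1\<close> are listed first, the left factor of the semi-strong product
  is \<open>[[I, P], [P^T, -I]]\<close>, because \<open>adjacency G1 = [[O, P], [P^T, O]]\<close>.\<close>

definition cartesian_matrix ::
    "'a::finite set \<Rightarrow> 'a sgraph \<Rightarrow> 'b::finite sgraph \<Rightarrow> real ^ ('a \<times> 'b) ^ ('a \<times> 'b)" where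
  "cartesian_matrix V1 G1 G2 =
     adjacency G1 \<otimes>\<^sub>K mat 1 + class_diag V1 \<otimes>\<^sub>K adjacency G2"

definition semistrong_matrix ::
    "'a::finite set \<Rightarrow> 'a sgraph \<Rightarrow> 'b::finite sgraph \<Rightarrow> real ^ ('a \<times> 'b) ^ ('a \<times> 'b)" where
  "semistrong_matrix V1 G1 G2 = (adjacency G1 + class_diag V1) \<otimes>\<^sub>K adjacency G2"

definition signed_cartesian ::
    "'a::finite set \<Rightarrow> 'a sgraph \<Rightarrow> 'b::finite sgraph \<Rightarrow> ('a \<times> 'b) sgraph" where
  "signed_cartesian V1 G1 G2 =
     sgraph_of_matrix (verts G1 \<times> verts G2) (cartesian_matrix V1 G1 G2)"

definition signed_semistrong ::
    "'a::finite set \<Rightarrow> 'a sgraph \<Rightarrow> 'b::finite sgraph \<Rightarrow> ('a \<times> 'b) sgraph" where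
  "signed_semistrong V1 G1 G2 =
     sgraph_of_matrix (verts G1 \<times> verts G2) (semistrong_matrix V1 G1 G2)"

text \<open>The products are signed graphs with the intended adjacency matrices.\<close>

lemma sign_sgraph_of_matrix:
  assumes "\<And>u v. M $ u $ v = M $ v $ u"
  shows "sign (sgraph_of_matrix V M) {u, v} = M $ u $ v"
proof -
  have "(THE s. \<exists>u' v'. {u, v} = {u', v'} \<and> s = M $ u' $ v') = M $ u $ v"
    by (rule the_equality) (auto simp: doubleton_eq_iff assms)
  then show ?thesis
    by (simp add: sgraph_of_matrix_def)
qed

lemma adjacency_sgraph_of_matrix:
  fixes M :: "real ^ 'a ^ 'a::finite"
  assumes sym: "\<And>u v. M $ u $ v = M $ v $ u"
  shows "adjacency (sgraph_of_matrix UNIV M) = M"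
proof -
  have "{u, v} \<in> edges (sgraph_of_matrix UNIV M) \<longleftrightarrow> M $ u $ v \<noteq> 0" for u v
    by (auto simp: sgraph_of_matrix_def doubleton_eq_iff sym)
  then show ?thesis
    by (simp add: adjacency_def vec_eq_iff sign_sgraph_of_matrix[OF sym])
qed

lemma signed_graph_sgraph_of_matrix:
  assumes sym: "\<And>u v. M $ u $ v = M $ v $ u" and diag: "\<And>u. M $ u $ u = 0"
    and ent: "\<And>u v. M $ u $ v \<in> {-1, 0, 1}" and fin: "finite V"
  shows "signed_graph (sgraph_of_matrix V M)"
proof -
  have "e \<subseteq> V \<and> card e = 2 \<and> (sign (sgraph_of_matrix V M) e = 1 \<or> sign (sgraph_of_matrix V M) e = -1)"
    if "e \<in> edges (sgraph_of_matrix V M)" for e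
  proof -
    from that obtain u v where e: "e = {u, v}" "u \<in> V" "v \<in> V" "M $ u $ v \<noteq> 0"
      by (auto simp: sgraph_of_matrix_def)
    with diag have "u \<noteq> v" by auto
    with e ent[of u v] show ?thesis
      by (auto simp: sign_sgraph_of_matrix[OF sym])
  qed
  moreover have "verts (sgraph_of_matrix V M) = V"
    by (simp add: sgraph_of_matrix_def)
  ultimately show ?thesis
    using fin unfolding signed_graph_def by metis
qed

lemma adjacency_sym: "adjacency G $ u $ v = adjacency G $ v $ u"
  by (simp add: adjacency_def insert_commute)

lemma adjacency_diag:
  assumes "signed_graph G" shows "adjacency G $ u $ u = 0"
  using assms by (auto simp: adjacency_def signed_graph_def)

lemma adjacency_entries:
  assumes "signed_graph G" shows "adjacency G $ u $ v \<in> {-1, 0, 1}"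
  using assms by (auto simp: adjacency_def signed_graph_def)

lemma cartesian_matrix_sym:
  "cartesian_matrix V1 G1 G2 $ p $ q = cartesian_matrix V1 G1 G2 $ q $ p"
  by (auto simp: cartesian_matrix_def kronecker_def class_diag_def mat_def adjacency_sym)

lemma semistrong_matrix_sym:
  "semistrong_matrix V1 G1 G2 $ p $ q = semistrong_matrix V1 G1 G2 $ q $ p"
  by (auto simp: semistrong_matrix_def kronecker_def class_diag_def adjacency_sym)

lemma adjacency_signed_cartesian:
  assumes "verts G1 = UNIV" "verts G2 = UNIV"
  shows "adjacency (signed_cartesian V1 G1 G2) = cartesian_matrix V1 G1 G2"
  using assms
  by (simp add: signed_cartesian_def adjacency_sgraph_of_matrix cartesian_matrix_sym)

lemma adjacency_signed_semistrong:
  assumes "verts G1 = UNIV" "verts G2 = UNIV"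
  shows "adjacency (signed_semistrong V1 G1 G2) = semistrong_matrix V1 G1 G2"
  using assms
  by (simp add: signed_semistrong_def adjacency_sgraph_of_matrix semistrong_matrix_sym)

lemma signed_graph_signed_cartesian:
  assumes "signed_graph G1" "signed_graph G2"
  shows "signed_graph (signed_cartesian V1 G1 G2)"
  unfolding signed_cartesian_def
proof (rule signed_graph_sgraph_of_matrix)
  fix p q
  show "cartesian_matrix V1 G1 G2 $ p $ p = 0"
    using assms by (simp add: cartesian_matrix_def kronecker_def adjacency_diag)
  show "cartesian_matrix V1 G1 G2 $ p $ q \<in> {-1, 0, 1}"
    using adjacency_entries[OF assms(1), of "fst p" "fst q"]
      adjacency_entries[OF assms(2), of "snd p" "snd q"]
      adjacency_diag[OF assms(1), of "fst p"]
    by (auto simp: cartesian_matrix_def kronecker_def class_diag_def mat_def)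
qed (simp_all add: cartesian_matrix_sym)

lemma signed_graph_signed_semistrong:
  assumes "signed_graph G1" "signed_graph G2"
  shows "signed_graph (signed_semistrong V1 G1 G2)"
  unfolding signed_semistrong_def
proof (rule signed_graph_sgraph_of_matrix)
  fix p q
  show "semistrong_matrix V1 G1 G2 $ p $ p = 0"
    using assms by (simp add: semistrong_matrix_def kronecker_def adjacency_diag)
  show "semistrong_matrix V1 G1 G2 $ p $ q \<in> {-1, 0, 1}"
    using adjacency_entries[OF assms(1), of "fst p" "fst q"]
      adjacency_entries[OF assms(2), of "snd p" "snd q"]
      adjacency_diag[OF assms(1), of "fst p"]
    by (auto simp: semistrong_matrix_def kronecker_def class_diag_def)
qed (simp_all add: semistrong_matrix_sym)

end

theory Submission
  imports Defs
begin

text \<open>A symmetric matrix with spectrum \<open>{\<theta>, -\<theta>}\<close> squares to \<open>\<theta>\<^sup>2\<close>, and the sign matrix \<open>D\<close> of the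
  bipartition anticommutes with \<open>A(\<Gamma>\<^sub>1)\<close>. Hence the product matrices \<open>M\<close> square to the scalars
  \<open>c = \<theta>\<^sub>1\<^sup>2 + \<theta>\<^sub>2\<^sup>2\<close> and \<open>c = (\<theta>\<^sub>1\<^sup>2 + 1) \<theta>\<^sub>2\<^sup>2\<close>, and the invertible matrix \<open>D A(\<Gamma>\<^sub>1) \<otimes> I\<close> anticommutes
  with both, so that the eigenvalues \<open>\<plusminus>sqrt c\<close> have equal multiplicity \<open>mn/2\<close>. For dimension
  reasons some \<open>sqrt c\<close>-eigenvector is supported on the \<open>mn/2 + 1\<close> vertices of \<open>H\<close>, and the row of \<open>M\<close> at an entry of maximal modulus
  shows that the degree of that vertex in \<open>H\<close> is at least \<open>sqrt c\<close>.\<close>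

section \<open>Self-adjoint maps and their eigenspaces\<close>

text \<open>A maximiser of the Rayleigh quotient on the unit sphere of \<open>S\<close> is an
  eigenvector: its residual \<open>f x - \<mu> *\<^sub>R x\<close> lies in \<open>S\<close>, and
  moving along a nonzero residual would increase the quotient to first order.\<close>

lemma selfadjoint_eigenvector:
  fixes f :: "'a::euclidean_space \<Rightarrow> 'a"
  assumes "linear f" and adj: "\<And>x y. f x \<bullet> y = x \<bullet> f y"
    and S: "subspace S" "f ` S \<subseteq> S" "S \<noteq> {0}"
  obtains x \<mu> where "x \<in> S" "x \<noteq> 0" "f x = \<mu> *\<^sub>R x"
proof -
  interpret linear f by fact
  let ?K = "S \<inter> sphere 0 1"
  obtain z where z: "z \<in> S" "z \<noteq> 0"
    using S(3) subspace_0[OF S(1)] by blast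
  then have "(1 / norm z) *\<^sub>R z \<in> ?K"
    using S(1) by (simp add: subspace_scale)
  moreover have "compact ?K"
    using S(1) by (intro closed_Int_compact closed_subspace) auto
  moreover have "continuous_on ?K (\<lambda>x. x \<bullet> f x)"
    using \<open>linear f\<close>
    by (intro continuous_intros linear_continuous_on) (simp add: linear_conv_bounded_linear)
  ultimately obtain x where x: "x \<in> ?K" and max: "\<And>y. y \<in> ?K \<Longrightarrow> y \<bullet> f y \<le> x \<bullet> f x"
    using continuous_attains_sup[of ?K] by blast
  define \<mu> where "\<mu> = x \<bullet> f x"
  \<comment> \<open>Homogeneous form of maximality: \<open>q\<close> is nonnegative on all of
    \<open>S\<close> and vanishes at \<open>x\<close>.\<close>
  define q where "q y = \<mu> * (y \<bullet> y) - y \<bullet> f y" for y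
  have q: "q y \<ge> 0" if "y \<in> S" for y
  proof (cases "y = 0")
    case False
    have "(1 / norm y) *\<^sub>R y \<in> ?K"
      using S(1) that False by (simp add: subspace_scale)
    from max[OF this] have "(y \<bullet> f y) / (norm y)\<^sup>2 \<le> \<mu>"
      by (simp add: \<mu>_def scale power2_eq_square)
    then show ?thesis
      using False by (simp add: q_def field_simps power2_norm_eq_inner)
  qed (simp add: q_def)
  define y where "y = f x - \<mu> *\<^sub>R x"
  have y: "y \<in> S"
    using x S unfolding y_def by (intro subspace_diff subspace_scale) auto
  have expand: "q (x + t *\<^sub>R y) = t\<^sup>2 * q y - 2 * t * (y \<bullet> y)" for t
  proof -
    have "x \<bullet> x = 1"
      using x by (simp add: dot_square_norm)
    moreover have "x \<bullet> f y = y \<bullet> f x"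
      using adj[of x y] by (simp add: inner_commute)
    moreover have "y \<bullet> y = y \<bullet> f x - \<mu> * (y \<bullet> x)"
      by (subst (2) y_def) (simp add: inner_diff_right)
    ultimately show ?thesis
      by (simp add: q_def add scale inner_add_left inner_add_right inner_commute[of x y]
          flip: \<mu>_def)
        (simp add: power2_eq_square algebra_simps)
  qed
  have "y = 0"
  proof (rule ccontr)
    assume "y \<noteq> 0"
    then have pos: "y \<bullet> y > 0" by simp
    \<comment> \<open>With this choice \<open>t * q y = y \<bullet> y - t\<close> stays below
      \<open>2 * (y \<bullet> y)\<close>, so the negative linear term in \<open>expand\<close> wins.
      The added 1 keeps the denominator positive even if \<open>q y = 0\<close>.\<close>
    define t where "t = (y \<bullet> y) / (q y + 1)"
    have "t > 0" "t * (q y + 1) = y \<bullet> y"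
      using pos q[OF y] by (auto simp: t_def)
    moreover have "0 \<le> t\<^sup>2 * q y - 2 * t * (y \<bullet> y)"
      using q[of "x + t *\<^sub>R y"] x y S(1) by (simp add: subspace_add subspace_scale expand)
    then have "0 \<le> t * (t * q y - 2 * (y \<bullet> y))"
      by (simp add: power2_eq_square algebra_simps)
    ultimately show False
      using pos by (simp add: zero_le_mult_iff algebra_simps)
  qed
  then show ?thesis
    using that[of x \<mu>] x by (cases "x = 0") (auto simp: y_def)
qed

text \<open>The range \<open>W\<close> of \<open>f\<^sup>2 - c\<close> is invariant under \<open>f\<close>; an eigenvector of \<open>f\<close> in \<open>W\<close> would lie in
  the kernel of \<open>f\<^sup>2 - c\<close> as well, hence be orthogonal to itself.\<close>

lemma selfadjoint_square_eq_scale: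
  fixes f :: "'a::euclidean_space \<Rightarrow> 'a"
  assumes "linear f" and adj: "\<And>x y. f x \<bullet> y = x \<bullet> f y"
    and eig: "\<And>x \<mu>. x \<noteq> 0 \<Longrightarrow> f x = \<mu> *\<^sub>R x \<Longrightarrow> \<mu>\<^sup>2 = c"
  shows "f (f x) = c *\<^sub>R x"
proof -
  interpret linear f by fact
  define g where "g x = f (f x) - c *\<^sub>R x" for x
  have g: "linear g"
    by unfold_locales (simp_all add: g_def add scale algebra_simps)
  have "range g = {0}"
  proof (rule ccontr)
    assume ne: "range g \<noteq> {0}"
    have "subspace (range g)"
      by (intro linear_subspace_image g subspace_UNIV)
    moreover have "f (g y) = g (f y)" for y
      by (simp add: g_def diff scale)
    then have "f ` range g \<subseteq> range g" by auto
    ultimately obtain x \<mu> where x: "x \<in> range g" "x \<noteq> 0" "f x = \<mu> *\<^sub>R x"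
      using selfadjoint_eigenvector[OF \<open>linear f\<close> adj _ _ ne] by blast
    from x(1) obtain y where y: "x = g y" by auto
    have "g x = 0"
      using eig[OF x(2,3)] x(3) by (simp add: g_def scale power2_eq_square)
    moreover have "x \<bullet> g y = g x \<bullet> y"
      by (simp add: g_def inner_diff_left inner_diff_right adj)
    ultimately show False
      using x(2) y by simp
  qed
  then have "g x = 0" by blast
  then show ?thesis by (simp add: g_def)
qed

text \<open>The map \<open>k\<close> exchanges the eigenspaces of \<open>r\<close> and \<open>-r\<close>, so both have half the dimension of
  the whole space.\<close>

lemma eigenvector_in_large_subspace:
  fixes f k :: "'a::euclidean_space \<Rightarrow> 'a"
  assumes "linear f" "linear k" "inj k" and anti: "\<And>x. f (k x) = - k (f x)"
    and sq: "\<And>x. f (f x) = r\<^sup>2 *\<^sub>R x" and "r \<noteq> 0"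
    and S: "subspace S" "DIM('a) < 2 * dim S"
  obtains x where "x \<in> S" "x \<noteq> 0" "f x = r *\<^sub>R x"
proof -
  interpret linear f by fact
  interpret k: linear k by fact
  define E where "E s = {x. f x = s *\<^sub>R x}" for s
  have E: "subspace (E s)" for s
    by (auto simp: E_def subspace_def add scale algebra_simps)
  have "k ` E (-r) \<subseteq> E r"
    by (auto simp: E_def anti k.scale k.neg)
  then have "dim (k ` E (-r)) \<le> dim (E r)"
    by (rule dim_subset)
  then have le: "dim (E (-r)) \<le> dim (E r)"
    using dim_image_eq[OF \<open>linear k\<close>, of "E (-r)"] \<open>inj k\<close> by (simp add: inj_on_subset)
  \<comment> \<open>The components are the spectral projections \<open>(r + f) / (2 * r)\<close> and
    \<open>(r - f) / (2 * r)\<close> applied to \<open>x\<close>; \<open>sq\<close> places them in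
    the two eigenspaces.\<close>
  have "x \<in> {u + v |u v. u \<in> E r \<and> v \<in> E (-r)}" for x
  proof -
    let ?u = "(1 / (2 * r)) *\<^sub>R (r *\<^sub>R x + f x)" and ?v = "(1 / (2 * r)) *\<^sub>R (r *\<^sub>R x - f x)"
    have "r *\<^sub>R x + f x \<in> E r" "r *\<^sub>R x - f x \<in> E (-r)"
      by (simp_all add: E_def add diff scale sq power2_eq_square scaleR_add_right scaleR_diff_right)
    then have "?u \<in> E r" "?v \<in> E (-r)"
      by (simp_all add: subspace_scale E)
    moreover have "(r *\<^sub>R x + f x) + (r *\<^sub>R x - f x) = (2 * r) *\<^sub>R x"
      unfolding mult_2 scaleR_add_left by simp
    then have "?u + ?v = (1 / (2 * r)) *\<^sub>R (2 * r) *\<^sub>R x"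
      by (metis scaleR_add_right)
    then have "x = ?u + ?v"
      using \<open>r \<noteq> 0\<close> unfolding scaleR_scaleR by simp
    ultimately show ?thesis by blast
  qed
  then have "{u + v |u v. u \<in> E r \<and> v \<in> E (-r)} = UNIV" by blast
  then have "DIM('a) \<le> dim (E r) + dim (E (-r))"
    using dim_sums_Int[OF E[of r] E[of "-r"]] by simp
  \<comment> \<open>\<open>E r\<close> has at least half the full dimension and \<open>S\<close>
    more than half, so the dimension formula forces a nonzero intersection.\<close>
  then have "DIM('a) < dim (E r) + dim S"
    using le S(2) by linarith
  then have "dim (E r \<inter> S) > 0"
    using dim_sums_Int[OF E[of r] S(1)] dim_subset_UNIV[of "{u + v |u v. u \<in> E r \<and> v \<in> S}"]
    by linarith
  then have "\<not> E r \<inter> S \<subseteq> {0}"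
    by (metis dim_eq_0 less_irrefl)
  then show ?thesis
    using that by (auto simp: E_def)
qed

section \<open>From the spectrum to the degree bound\<close>

lemma adjacency_square:
  assumes "spectrum (adjacency G) = {\<theta>, -\<theta>}"
  shows "adjacency G ** adjacency G = \<theta>\<^sup>2 *\<^sub>R mat 1"
proof -
  let ?A = "adjacency G"
  have "transpose ?A = ?A"
    by (simp add: transpose_def vec_eq_iff adjacency_sym)
  then have adj: "(?A *v x) \<bullet> y = x \<bullet> (?A *v y)" for x y
    by (metis dot_lmul_matrix vector_transpose_matrix)
  have eig: "\<mu>\<^sup>2 = \<theta>\<^sup>2" if "x \<noteq> 0" "?A *v x = \<mu> *\<^sub>R x" for x \<mu>
  proof -
    have "\<mu> \<in> spectrum ?A" using that by (auto simp: spectrum_def)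
    then show ?thesis using assms by auto
  qed
  have "?A *v (?A *v x) = \<theta>\<^sup>2 *\<^sub>R x" for x
    by (rule selfadjoint_square_eq_scale[OF matrix_vector_mul_linear adj eig])
  then show ?thesis
    by (simp add: matrix_eq matrix_vector_mul_assoc[symmetric] scaleR_matrix_vector_assoc[symmetric])
qed

text \<open>This isolates the argument shared by both products. The scalar \<open>d\<close> may be
  negative: \<open>K\<close> serves as an injective map that anticommutes with
  \<open>M\<close>.\<close>

lemma max_degree_induced_subgraph:
  fixes M K :: "real ^ 'a ^ 'a::finite"
  assumes ind: "induced_subgraph H (sgraph_of_matrix UNIV M)"
    and card: "CARD('a) < 2 * card (verts H)"
    and ent: "\<And>u v. \<bar>M $ u $ v\<bar> \<le> 1"
    and sq: "M ** M = c *\<^sub>R mat 1" and "c > 0"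
    and anti: "M ** K = - (K ** M)" and inv: "K ** K = d *\<^sub>R mat 1" and "d \<noteq> 0"
  shows "real (max_degree H) \<ge> sqrt c"
proof -
  define S where "S = {x :: real ^ 'a. \<forall>i. i \<notin> verts H \<longrightarrow> x $ i = 0}"
  have "dim S = card (verts H)"
    by (simp add: S_def dim_substandard_cart flip: dim_vec_eq)
  moreover have "subspace S"
    by (auto simp: S_def subspace_def)
  moreover have "inj ((*v) K)"
  proof (rule inj_on_inverseI)
    show "(1 / d) *\<^sub>R (K *v (K *v x)) = x" for x
      using \<open>d \<noteq> 0\<close>
      by (simp add: matrix_vector_mul_assoc inv scaleR_matrix_vector_assoc[symmetric])
  qed
  moreover have "M *v (K *v x) = - (K *v (M *v x))" for x
    by (simp add: matrix_vector_mul_assoc anti)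
      (simp add: vec_eq_iff matrix_vector_mult_def sum_negf)
  moreover have "M *v (M *v x) = (sqrt c)\<^sup>2 *\<^sub>R x" for x
    using \<open>c > 0\<close>
    by (simp add: matrix_vector_mul_assoc sq scaleR_matrix_vector_assoc[symmetric])
  ultimately obtain x where x: "x \<in> S" "x \<noteq> 0" "M *v x = sqrt c *\<^sub>R x"
    using eigenvector_in_large_subspace[of "(*v) M" "(*v) K" "sqrt c" S] \<open>c > 0\<close> card by auto
  have "Max (range (\<lambda>i. \<bar>x $ i\<bar>)) \<in> range (\<lambda>i. \<bar>x $ i\<bar>)"
    by (rule Max_in) auto
  then obtain u where u: "\<bar>x $ u\<bar> = Max (range (\<lambda>i. \<bar>x $ i\<bar>))"
    by (metis rangeE)
  have le: "\<bar>x $ v\<bar> \<le> \<bar>x $ u\<bar>" for v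
    unfolding u by (rule Max_ge) auto
  obtain w where "x $ w \<noteq> 0"
    using x(2) by (auto simp: vec_eq_iff)
  with le[of w] have pos: "\<bar>x $ u\<bar> > 0" by simp
  then have uH: "u \<in> verts H"
    using x(1) by (auto simp: S_def)
  let ?N = "{v \<in> verts H. {u, v} \<in> edges H}"
  \<comment> \<open>Since \<open>x\<close> vanishes off \<open>verts H\<close> and \<open>H\<close>
    is induced, row \<open>u\<close> of \<open>M *v x\<close> receives contributions only from
    neighbours of \<open>u\<close> inside \<open>H\<close>.\<close>
  have N: "v \<in> ?N" if "M $ u $ v \<noteq> 0" "x $ v \<noteq> 0" for v
    using that x(1) uH ind by (auto simp: S_def induced_subgraph_def sgraph_of_matrix_def)
  have "sqrt c * \<bar>x $ u\<bar> = \<bar>(M *v x) $ u\<bar>"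
    using \<open>c > 0\<close> by (simp add: x(3) abs_mult)
  also have "\<dots> \<le> (\<Sum>v\<in>UNIV. \<bar>M $ u $ v * x $ v\<bar>)"
    by (simp add: matrix_vector_mult_def sum_abs)
  also have "\<dots> = (\<Sum>v\<in>?N. \<bar>M $ u $ v * x $ v\<bar>)"
    using N by (intro sum.mono_neutral_right) auto
  also have "\<dots> \<le> (\<Sum>v\<in>?N. 1 * \<bar>x $ u\<bar>)"
    unfolding abs_mult by (intro sum_mono mult_mono ent le) auto
  also have "\<dots> = real (degree H u) * \<bar>x $ u\<bar>"
    by (simp add: degree_def)
  finally have "sqrt c \<le> real (degree H u)"
    using pos by simp
  also have "degree H u \<le> max_degree H"
    unfolding max_degree_def using uH by (intro Max_ge) auto
  finally show ?thesis by simp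
qed

section \<open>Kronecker products and the signs of the bipartition\<close>

lemma kronecker_mult: "(A \<otimes>\<^sub>K B) ** (C \<otimes>\<^sub>K D) = (A ** C) \<otimes>\<^sub>K (B ** D)"
  by (simp add: kronecker_def matrix_matrix_mult_def vec_eq_iff sum_product sum.cartesian_product
      UNIV_Times_UNIV[symmetric] case_prod_unfold mult_ac del: UNIV_Times_UNIV)

lemma kronecker_add_left: "(A + B) \<otimes>\<^sub>K C = A \<otimes>\<^sub>K C + B \<otimes>\<^sub>K C"
  and kronecker_uminus_left: "(- A) \<otimes>\<^sub>K C = - (A \<otimes>\<^sub>K C)"
  and kronecker_scaleR_left: "(r *\<^sub>R A) \<otimes>\<^sub>K C = r *\<^sub>R (A \<otimes>\<^sub>K C)"
  and kronecker_scaleR_right: "A \<otimes>\<^sub>K (r *\<^sub>R C) = r *\<^sub>R (A \<otimes>\<^sub>K C)"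
  by (simp_all add: kronecker_def vec_eq_iff algebra_simps)

lemma kronecker_mat_1: "mat 1 \<otimes>\<^sub>K mat 1 = mat 1"
  by (auto simp: kronecker_def vec_eq_iff mat_def prod_eq_iff)

lemma matrix_mult_add_left: "(A + B) ** C = A ** C + B ** C"
  by (simp add: matrix_matrix_mult_def vec_eq_iff sum.distrib distrib_right)

lemma matrix_mult_uminus:
  fixes A :: "real ^ 'n ^ 'm" and B :: "real ^ 'p ^ 'n"
  shows "(- A) ** B = - (A ** B)" "A ** (- B) = - (A ** B)"
  by (simp_all add: matrix_matrix_mult_def vec_eq_iff sum_negf)

lemma matrix_mult_scaleR:
  fixes A :: "real ^ 'n ^ 'm" and B :: "real ^ 'p ^ 'n"
  shows "(r *\<^sub>R A) ** B = r *\<^sub>R (A ** B)" "A ** (r *\<^sub>R B) = r *\<^sub>R (A ** B)"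
  by (simp_all add: matrix_matrix_mult_def vec_eq_iff sum_distrib_left mult_ac)

lemma class_diag_nth:
  "(class_diag V ** A) $ u $ v = (if u \<in> V then 1 else -1) * A $ u $ v"
  "(A ** class_diag V) $ u $ v = A $ u $ v * (if v \<in> V then 1 else -1)"
  by (simp_all add: class_diag_def matrix_matrix_mult_def if_distrib[of "\<lambda>x. x * _"]
      if_distrib[of "\<lambda>x. _ * x"] cong: if_cong)

lemma class_diag_square: "class_diag V ** class_diag V = mat 1"
  by (simp add: vec_eq_iff class_diag_nth) (simp add: class_diag_def mat_def)

text \<open>Multiplying by \<open>class_diag V1\<close> on the left signs row \<open>u\<close>, on
  the right column \<open>v\<close>. At a nonzero entry \<open>u\<close> and \<open>v\<close> lie in
  opposite classes, so the two signs differ.\<close>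

lemma adjacency_class_diag_anticommute:
  assumes "bipartition G V1 V2"
  shows "adjacency G ** class_diag V1 = - (class_diag V1 ** adjacency G)"
proof -
  have "(u \<in> V1) \<noteq> (v \<in> V1)" if "{u, v} \<in> edges G" for u v
    using assms that unfolding bipartition_def by (fastforce simp: doubleton_eq_iff)
  then show ?thesis
    by (auto simp: vec_eq_iff class_diag_nth adjacency_def)
qed

theorem theorem1p2:
  fixes \<Gamma>1 :: "'a::finite sgraph" and \<Gamma>2 :: "'b::finite sgraph"
    and H H' :: "('a \<times> 'b) sgraph"
    and V1 V2 :: "'a set" and n m :: nat and \<theta>1 \<theta>2 :: real
  assumes "signed_graph \<Gamma>1" and "verts \<Gamma>1 = UNIV" and "card (verts \<Gamma>1) = n"
    and "bipartition \<Gamma>1 V1 V2"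
    and "spectrum (adjacency \<Gamma>1) = {\<theta>1, - \<theta>1}" and "\<theta>1 \<noteq> - \<theta>1"
    and "signed_graph \<Gamma>2" and "verts \<Gamma>2 = UNIV" and "card (verts \<Gamma>2) = m"
    and "spectrum (adjacency \<Gamma>2) = {\<theta>2, - \<theta>2}" and "\<theta>2 \<noteq> - \<theta>2"
    and "induced_subgraph H (signed_cartesian V1 \<Gamma>1 \<Gamma>2)"
    and "real (card (verts H)) = real (m * n) / 2 + 1"
    and "induced_subgraph H' (signed_semistrong V1 \<Gamma>1 \<Gamma>2)"
    and "real (card (verts H')) = real (m * n) / 2 + 1"
  shows "real (max_degree H) \<ge> sqrt (\<theta>1\<^sup>2 + \<theta>2\<^sup>2) \<and>
         real (max_degree H') \<ge> sqrt ((\<theta>1\<^sup>2 + 1) * \<theta>2\<^sup>2)"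
proof -
  let ?A = "adjacency \<Gamma>1" and ?B = "adjacency \<Gamma>2" and ?D = "class_diag V1 :: real ^ 'a ^ 'a"
  let ?M = "cartesian_matrix V1 \<Gamma>1 \<Gamma>2" and ?M' = "semistrong_matrix V1 \<Gamma>1 \<Gamma>2"
  \<comment> \<open>\<open>?D ** ?A\<close> anticommutes with both \<open>?A\<close> and
    \<open>?D\<close>, and \<open>mat 1\<close> commutes with \<open>?B\<close>, so \<open>K\<close>
    anticommutes with every summand of \<open>?M\<close> and \<open>?M'\<close>.\<close>
  define K :: "real ^ ('a \<times> 'b) ^ ('a \<times> 'b)" where "K = (?D ** ?A) \<otimes>\<^sub>K mat 1"
  have \<theta>: "\<theta>1\<^sup>2 > 0" "\<theta>2\<^sup>2 > 0"
    using assms by auto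
  have AA: "?A ** ?A = \<theta>1\<^sup>2 *\<^sub>R mat 1" and BB: "?B ** ?B = \<theta>2\<^sup>2 *\<^sub>R mat 1"
    using assms by (auto intro: adjacency_square)
  have AD: "?A ** ?D = - (?D ** ?A)"
    using assms by (auto intro: adjacency_class_diag_anticommute)
  have ADX: "?A ** (?D ** X) = - (?D ** (?A ** X))" for X :: "real ^ 'a ^ 'a"
    by (simp add: matrix_mul_assoc AD matrix_mult_uminus)
  have DD: "?D ** ?D = mat 1"
    by (rule class_diag_square)
  have DDX: "?D ** (?D ** X) = X" for X :: "real ^ 'a ^ 'a"
    by (simp add: matrix_mul_assoc DD)
  \<comment> \<open>Rewriting moves \<open>?D\<close> to the left of \<open>?A\<close> and collapses
    squares; \<open>ADX\<close> and \<open>DDX\<close> do this inside right-nested products.\<close>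
  note rules = kronecker_mult matrix_add_ldistrib matrix_mult_add_left AA BB AD ADX DD DDX
    kronecker_add_left kronecker_uminus_left kronecker_scaleR_left kronecker_scaleR_right
    kronecker_mat_1 matrix_mult_uminus matrix_mult_scaleR matrix_mul_assoc[symmetric]
  \<comment> \<open>Doubling \<open>m * n / 2 + 1\<close> gives \<open>m * n + 2\<close>, hence the
    strict inequality.\<close>
  have card: "CARD('a \<times> 'b) < 2 * card (verts H)" "CARD('a \<times> 'b) < 2 * card (verts H')"
  proof -
    have "CARD('a \<times> 'b) = m * n"
      using assms by (simp add: mult.commute)
    then show "CARD('a \<times> 'b) < 2 * card (verts H)" "CARD('a \<times> 'b) < 2 * card (verts H')"
      using assms(13,15) by linarith+
  qed
  have KK: "K ** K = (- (\<theta>1\<^sup>2)) *\<^sub>R mat 1"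
    by (simp add: K_def rules)
  have ind: "induced_subgraph H (sgraph_of_matrix UNIV ?M)"
    "induced_subgraph H' (sgraph_of_matrix UNIV ?M')"
    using assms by (simp_all add: signed_cartesian_def signed_semistrong_def)
  have ent: "\<bar>adjacency G $ u $ v\<bar> \<le> 1" if "signed_graph G" for G :: "('c::finite) sgraph" and u v
    using adjacency_entries[OF that, of u v] by auto
  have "\<bar>adjacency (signed_cartesian V1 \<Gamma>1 \<Gamma>2) $ p $ q\<bar> \<le> 1" for p q
    using assms by (intro ent signed_graph_signed_cartesian)
  then have entM: "\<bar>?M $ p $ q\<bar> \<le> 1" for p q
    using assms by (simp add: adjacency_signed_cartesian)
  have "\<bar>adjacency (signed_semistrong V1 \<Gamma>1 \<Gamma>2) $ p $ q\<bar> \<le> 1" for p q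
    using assms by (intro ent signed_graph_signed_semistrong)
  then have entM': "\<bar>?M' $ p $ q\<bar> \<le> 1" for p q
    using assms by (simp add: adjacency_signed_semistrong)
  \<comment> \<open>The cross terms \<open>(?A ** ?D) \<otimes>\<^sub>K ?B\<close> and
    \<open>(?D ** ?A) \<otimes>\<^sub>K ?B\<close> cancel.\<close>
  have "?M ** ?M = (\<theta>1\<^sup>2 + \<theta>2\<^sup>2) *\<^sub>R mat 1"
    by (simp add: cartesian_matrix_def rules scaleR_add_left)
  moreover have "?M ** K = - (K ** ?M)"
    by (simp add: cartesian_matrix_def K_def rules)
  ultimately have "real (max_degree H) \<ge> sqrt (\<theta>1\<^sup>2 + \<theta>2\<^sup>2)"
    using \<theta> KK
    by (intro max_degree_induced_subgraph[OF ind(1) card(1) entM,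
          where K = K and d = "- (\<theta>1\<^sup>2)"])
      (simp_all add: add_pos_pos)
  \<comment> \<open>The same cancellation makes \<open>?A + ?D\<close> square to the scalar
    \<open>\<theta>1\<^sup>2 + 1\<close>.\<close>
  moreover have "?M' ** ?M' = ((\<theta>1\<^sup>2 + 1) * \<theta>2\<^sup>2) *\<^sub>R mat 1"
    by (simp add: semistrong_matrix_def rules scaleR_add_left algebra_simps)
  moreover have "?M' ** K = - (K ** ?M')"
    by (simp add: semistrong_matrix_def K_def rules)
  ultimately show ?thesis
    using \<theta> KK
    by (intro conjI max_degree_induced_subgraph[OF ind(2) card(2) entM',
          where K = K and d = "- (\<theta>1\<^sup>2)"])
      (simp_all add: add_pos_pos)
qed

end
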